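(* Let $(G,\zeta)$, $(K,\xi)$ be quandle envelopes on a set $Q$ with a fixed element $e\in Q$, and let - $A$ be the set of all quandle isomorphisms $\varphi:\mathcal Q(G,\zeta)\to\mathcal Q(K,\xi)$ such that $e^\varphi=e$; - $B$ be the set of all permutations $\varphi$ of $Q$ such that $e^\varphi=e$, $\zeta^\varphi=\xi$ and $G^\varphi=K$; - $C$ be the set of all group isomorphisms $\psi:G\to K$ such that $\zeta^\psi=\xi$ and $(G_e)^{\psi}=K_e$. Then $A=B$, and $\varphi\mapsto\phi_\varphi$ is a bijection from $A=B$ to $C$, where $\phi_\varphi$ denotes conjugation by $\varphi$, $\alpha\mapsto\varphi^{-1}\alpha\varphi$ (restricted to $G$).
   Context: Mappings are applied on the right, as superscripts: $x^{\alpha\beta}=(x^\alpha)^\beta$. For permutations, $\alpha^\varphi=\varphi^{-1}\alpha\varphi$ and $G^\varphi=\varphi^{-1}G\varphi$; for a group isomorphism $\psi$, $\alpha^\psi$ is the image of $\alpha$ and $(G_e)^\psi$ the image of $G_e$. A quandle is a set with a binary operation such that all right translations $R_x:y\mapsto yx$ are automorphisms and $xx=x$ for all $x$. A quandle envelope on $Q$ (with respect to $e$) is a pair $(G,\zeta)$ where $G$ is a transitive permutation group on $Q$, $\zeta\in Z(G_e)$ (the center of the stabilizer of $e$), and $\langle\zeta^G\rangle=G$ (the smallest normal subgroup of $G$ containing $\zeta$ is $G$). The quandle $\mathcal Q(G,\zeta)=(Q,\circ)$ is defined by $x\circ y=x^{\zeta^{\widehat y}}$, where $\widehat y$ is any element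 of $G$ with $e^{\widehat y}=y$ (the operation does not depend on the choice of $\widehat y$). *)

theory Defs
  imports "HOL-Algebra.Algebra"
begin

section \<open>Quandles\<close>

text \<open>
  A set with a binary operation is given as a carrier together with a curried function, of which
  only the values on the carrier matter. Maps are made extensional so that two isomorphisms are
  equal as soon as they agree on the carrier.
\<close>

definition binop_iso ::
  "'a set \<Rightarrow> ('a \<Rightarrow> 'a \<Rightarrow> 'a) \<Rightarrow> 'b set \<Rightarrow> ('b \<Rightarrow> 'b \<Rightarrow> 'b) \<Rightarrow> ('a \<Rightarrow> 'b) set"
  where "binop_iso S f T g =
    {\<phi> \<in> extensional S. bij_betw \<phi> S T \<and> (\<forall>x\<in>S. \<forall>y\<in>S. \<phi> (f x y) = g (\<phi> x) (\<phi> y))}"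

definition quandle :: "'a set \<Rightarrow> ('a \<Rightarrow> 'a \<Rightarrow> 'a) \<Rightarrow> bool"
  where "quandle S f \<longleftrightarrow>
    (\<forall>x\<in>S. \<forall>y\<in>S. f x y \<in> S) \<and>
    (\<forall>x\<in>S. (\<lambda>y\<in>S. f y x) \<in> binop_iso S f S f) \<and>
    (\<forall>x\<in>S. f x x = x)"

definition quandle_iso ::
  "'a set \<Rightarrow> ('a \<Rightarrow> 'a \<Rightarrow> 'a) \<Rightarrow> 'b set \<Rightarrow> ('b \<Rightarrow> 'b \<Rightarrow> 'b) \<Rightarrow> ('a \<Rightarrow> 'b) set"
  where "quandle_iso S f T g = {\<phi> \<in> binop_iso S f T g. quandle S f \<and> quandle T g}"


section \<open>Permutation groups and quandle envelopes\<close>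

text \<open>
  Permutations of \<open>Q\<close> are the elements of \<open>Bij Q\<close>, and permutation groups on \<open>Q\<close> are
  subgroups of \<open>BijGroup Q\<close>. There \<open>\<alpha> \<otimes> \<beta>\<close> applies \<open>\<beta>\<close> first, whereas with mappings written on
  the right \<open>\<alpha>\<beta>\<close> applies \<open>\<alpha>\<close> first. Passing to the opposite group changes neither the subgroups,
  centers and stabilizers nor the isomorphisms between subgroups; in products the factors are
  reversed.
\<close>

abbreviation perm_group :: "'a set \<Rightarrow> ('a \<Rightarrow> 'a) set \<Rightarrow> ('a \<Rightarrow> 'a) monoid"
  where "perm_group Q G \<equiv> BijGroup Q\<lparr>carrier := G\<rparr>"

abbreviation perm_stab :: "'a set \<Rightarrow> ('a \<Rightarrow> 'a) set \<Rightarrow> 'a \<Rightarrow> ('a \<Rightarrow> 'a) set"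
  where "perm_stab Q G e \<equiv> stabilizer (perm_group Q G) (\<lambda>g. g) e"

definition center :: "('a, 'b) monoid_scheme \<Rightarrow> 'a set"
  where "center G = {z \<in> carrier G. \<forall>g\<in>carrier G. g \<otimes>\<^bsub>G\<^esub> z = z \<otimes>\<^bsub>G\<^esub> g}"

text \<open>
  The conjugate \<open>\<alpha>\<^sup>\<phi>\<close>, which is \<open>\<phi>\<inverse>\<alpha>\<phi>\<close> in right notation: apply \<open>\<phi>\<inverse>\<close>, then \<open>\<alpha>\<close>, then \<open>\<phi>\<close>.
\<close>

definition perm_conj :: "'a set \<Rightarrow> ('a \<Rightarrow> 'a) \<Rightarrow> ('a \<Rightarrow> 'a) \<Rightarrow> ('a \<Rightarrow> 'a)"
  where "perm_conj Q \<alpha> \<phi> = \<phi> \<otimes>\<^bsub>BijGroup Q\<^esub> \<alpha> \<otimes>\<^bsub>BijGroup Q\<^esub> inv\<^bsub>BijGroup Q\<^esub> \<phi>"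

definition quandle_envelope :: "'a set \<Rightarrow> 'a \<Rightarrow> ('a \<Rightarrow> 'a) set \<Rightarrow> ('a \<Rightarrow> 'a) \<Rightarrow> bool"
  where "quandle_envelope Q e G \<zeta> \<longleftrightarrow>
    subgroup G (BijGroup Q) \<and>
    transitive_action (perm_group Q G) Q (\<lambda>g. g) \<and>
    \<zeta> \<in> center (perm_group Q (perm_stab Q G e)) \<and>
    generate (perm_group Q G) (perm_conj Q \<zeta> ` G) = G"

text \<open>The operation of \<open>\<Q>(G, \<zeta>)\<close>; see \<open>envelope_op_eq\<close> for the independence of the choice.\<close>

definition envelope_op ::
  "'a \<Rightarrow> 'a set \<Rightarrow> ('a \<Rightarrow> 'a) set \<Rightarrow> ('a \<Rightarrow> 'a) \<Rightarrow> 'a \<Rightarrow> 'a \<Rightarrow> 'a"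
  where "envelope_op e Q G \<zeta> x y = perm_conj Q \<zeta> (SOME g. g \<in> G \<and> g e = y) x"


section \<open>The quandle of an envelope\<close>

lemma BijGroup_mult_apply:
  assumes "f \<in> Bij Q" "g \<in> Bij Q" "x \<in> Q"
  shows "(f \<otimes>\<^bsub>BijGroup Q\<^esub> g) x = f (g x)"
  using assms by (simp add: BijGroup_def compose_eq)

lemma carrier_BijGroup: "carrier (BijGroup Q) = Bij Q"
  by (simp add: BijGroup_def)

lemma perm_conj_Bij:
  assumes "a \<in> Bij Q" "\<phi> \<in> Bij Q"
  shows "perm_conj Q a \<phi> \<in> Bij Q"
proof -
  interpret group "BijGroup Q" by (rule group_BijGroup)
  show ?thesis using assms unfolding perm_conj_def by (simp flip: carrier_BijGroup)
qed

lemma perm_conj_apply: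
  assumes a: "a \<in> Bij Q" and p: "\<phi> \<in> Bij Q" and x: "x \<in> Q"
  shows "perm_conj Q a \<phi> (\<phi> x) = \<phi> (a x)"
proof -
  interpret group "BijGroup Q" by (rule group_BijGroup)
  have "perm_conj Q a \<phi> \<otimes>\<^bsub>BijGroup Q\<^esub> \<phi> = \<phi> \<otimes>\<^bsub>BijGroup Q\<^esub> a"
    using a p unfolding perm_conj_def by (simp add: m_assoc flip: carrier_BijGroup)
  then have "(perm_conj Q a \<phi> \<otimes>\<^bsub>BijGroup Q\<^esub> \<phi>) x = (\<phi> \<otimes>\<^bsub>BijGroup Q\<^esub> a) x" by simp
  then show ?thesis using assms by (simp add: BijGroup_mult_apply perm_conj_Bij)
qed

lemma Bij_mem: "f \<in> Bij Q \<Longrightarrow> x \<in> Q \<Longrightarrow> f x \<in> Q"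
  using Bij_imp_funcset by blast

lemma envelope_facts:
  assumes "quandle_envelope Q e G \<zeta>"
  shows "G \<subseteq> Bij Q" "\<zeta> \<in> G" "\<zeta> e = e"
    "\<And>k. k \<in> G \<Longrightarrow> k e = e \<Longrightarrow> k \<otimes>\<^bsub>BijGroup Q\<^esub> \<zeta> = \<zeta> \<otimes>\<^bsub>BijGroup Q\<^esub> k"
    "\<And>x y. x \<in> Q \<Longrightarrow> y \<in> Q \<Longrightarrow> \<exists>g\<in>G. g x = y"
proof -
  show "G \<subseteq> Bij Q"
    using assms subgroup.subset unfolding quandle_envelope_def carrier_BijGroup[symmetric] by blast
  show "\<zeta> \<in> G" "\<zeta> e = e"
    "\<And>k. k \<in> G \<Longrightarrow> k e = e \<Longrightarrow> k \<otimes>\<^bsub>BijGroup Q\<^esub> \<zeta> = \<zeta> \<otimes>\<^bsub>BijGroup Q\<^esub> k"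
    using assms unfolding quandle_envelope_def center_def stabilizer_def by auto
  show "\<And>x y. x \<in> Q \<Longrightarrow> y \<in> Q \<Longrightarrow> \<exists>g\<in>G. g x = y"
    using assms transitive_action.unique_orbit unfolding quandle_envelope_def by fastforce
qed

lemma perm_conj_independent:
  assumes env: "quandle_envelope Q e G \<zeta>" and e: "e \<in> Q"
    and g: "g \<in> G" and h: "h \<in> G" and eq: "g e = h e"
  shows "perm_conj Q \<zeta> g = perm_conj Q \<zeta> h"
proof -
  interpret group "BijGroup Q" by (rule group_BijGroup)
  have sub: "subgroup G (BijGroup Q)" using env by (simp add: quandle_envelope_def)
  note F = envelope_facts[OF env]
  have B: "g \<in> carrier (BijGroup Q)" "h \<in> carrier (BijGroup Q)" "\<zeta> \<in> carrier (BijGroup Q)"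
    using F(1,2) g h by (auto simp: carrier_BijGroup)
  define k where "k = inv\<^bsub>BijGroup Q\<^esub> h \<otimes>\<^bsub>BijGroup Q\<^esub> g"
  have kG: "k \<in> G"
    using sub g h unfolding k_def by (simp add: subgroup.m_closed subgroup.m_inv_closed)
  have kB: "k \<in> carrier (BijGroup Q)" using B by (simp add: k_def)
  have gk: "g = h \<otimes>\<^bsub>BijGroup Q\<^esub> k" using B by (simp add: k_def flip: m_assoc)
  have "h (k e) = h e"
    using gk eq B(2) kB e by (metis BijGroup_mult_apply carrier_BijGroup)
  moreover have "inj_on h Q" using B(2) by (simp add: carrier_BijGroup Bij_def bij_betw_def)
  moreover have "k e \<in> Q" using Bij_mem kB e carrier_BijGroup by metis
  ultimately have "k e = e" using e by (meson inj_onD)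
  then have comm: "k \<otimes>\<^bsub>BijGroup Q\<^esub> \<zeta> = \<zeta> \<otimes>\<^bsub>BijGroup Q\<^esub> k" using F(4) kG by blast
  have kz: "k \<otimes>\<^bsub>BijGroup Q\<^esub> (\<zeta> \<otimes>\<^bsub>BijGroup Q\<^esub> inv\<^bsub>BijGroup Q\<^esub> k) = \<zeta>"
    using B(3) kB comm by (simp add: m_assoc[symmetric]) (simp add: m_assoc)
  have "perm_conj Q \<zeta> g =
      h \<otimes>\<^bsub>BijGroup Q\<^esub> (k \<otimes>\<^bsub>BijGroup Q\<^esub> (\<zeta> \<otimes>\<^bsub>BijGroup Q\<^esub> inv\<^bsub>BijGroup Q\<^esub> k))
        \<otimes>\<^bsub>BijGroup Q\<^esub> inv\<^bsub>BijGroup Q\<^esub> h"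
    unfolding perm_conj_def gk using B kB by (simp add: m_assoc inv_mult_group)
  then show ?thesis unfolding kz by (simp add: perm_conj_def)
qed

lemma envelope_op_eq:
  assumes env: "quandle_envelope Q e G \<zeta>" and e: "e \<in> Q" and g: "g \<in> G" and y: "g e = y"
  shows "envelope_op e Q G \<zeta> x y = perm_conj Q \<zeta> g x"
proof -
  have "\<exists>g. g \<in> G \<and> g e = y" using g y by blast
  from someI_ex[OF this] show ?thesis
    unfolding envelope_op_def using perm_conj_independent[OF env e] g y by metis
qed

lemma envelope_op_quandle:
  assumes env: "quandle_envelope Q e G \<zeta>" and e: "e \<in> Q"
  shows "quandle Q (envelope_op e Q G \<zeta>)"
proof -
  interpret group "BijGroup Q" by (rule group_BijGroup)
  have sub: "subgroup G (BijGroup Q)" using env by (simp add: quandle_envelope_def)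
  note F = envelope_facts[OF env]
  let ?f = "envelope_op e Q G \<zeta>"
  have R: "\<exists>g\<in>G. g e = y \<and> perm_conj Q \<zeta> g \<in> G \<and> (\<forall>x. ?f x y = perm_conj Q \<zeta> g x)"
    if y: "y \<in> Q" for y
  proof -
    obtain g where g: "g \<in> G" "g e = y" using F(5)[OF e y] by blast
    moreover have "perm_conj Q \<zeta> g \<in> G"
      using sub g(1) F(2) unfolding perm_conj_def
      by (simp add: subgroup.m_closed subgroup.m_inv_closed)
    ultimately show ?thesis using envelope_op_eq[OF env e g] by blast
  qed
  have equiv: "h (?f x y) = ?f (h x) (h y)" if h: "h \<in> G" and x: "x \<in> Q" and y: "y \<in> Q" for h x y
  proof -
    obtain g where g: "g \<in> G" "g e = y" using F(5)[OF e y] by blast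
    have hB: "h \<in> Bij Q" and gB: "g \<in> Bij Q" and zB: "\<zeta> \<in> Bij Q" using F(1,2) g h by auto
    have hg: "h \<otimes>\<^bsub>BijGroup Q\<^esub> g \<in> G" using sub h g(1) by (simp add: subgroup.m_closed)
    have hge: "(h \<otimes>\<^bsub>BijGroup Q\<^esub> g) e = h y" using BijGroup_mult_apply[OF hB gB e] g(2) by simp
    have "g ` Q = Q" using gB by (simp add: Bij_def bij_betw_def)
    then obtain u where u: "u \<in> Q" "x = g u" using x by blast
    have hgu: "h x = (h \<otimes>\<^bsub>BijGroup Q\<^esub> g) u" using BijGroup_mult_apply[OF hB gB u(1)] u(2) by simp
    have "?f (h x) (h y) = (h \<otimes>\<^bsub>BijGroup Q\<^esub> g) (\<zeta> u)"
      unfolding envelope_op_eq[OF env e hg hge] hgu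
      using perm_conj_apply[OF zB _ u(1)] hg F(1) by blast
    also have "\<dots> = h (g (\<zeta> u))"
      using BijGroup_mult_apply[OF hB gB] Bij_mem[OF zB u(1)] by simp
    also have "g (\<zeta> u) = ?f x y"
      unfolding envelope_op_eq[OF env e g] u(2) using perm_conj_apply[OF zB gB u(1)] by simp
    finally show ?thesis by simp
  qed
  have closed: "?f x y \<in> Q" if "x \<in> Q" "y \<in> Q" for x y
    using R[OF that(2)] F(1) Bij_mem that(1) by (metis subsetD)
  have "(\<lambda>y\<in>Q. ?f y x) \<in> binop_iso Q ?f Q ?f" if x: "x \<in> Q" for x
  proof -
    obtain h where h: "h \<in> G" "\<forall>y. ?f y x = h y" using R[OF x] by blast
    have hB: "h \<in> Bij Q" using h F(1) by blast
    have "(\<lambda>y\<in>Q. ?f y x) = h" using h(2) hB by (auto simp: Bij_def extensional_restrict)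
    then show ?thesis using hB equiv[OF h(1)] by (auto simp: binop_iso_def Bij_def)
  qed
  moreover have "?f x x = x" if x: "x \<in> Q" for x
  proof -
    obtain g where g: "g \<in> G" "g e = x" using F(5)[OF e x] by blast
    have "perm_conj Q \<zeta> g (g e) = g (\<zeta> e)" using perm_conj_apply[OF _ _ e] F(1,2) g by blast
    then show ?thesis using envelope_op_eq[OF env e g] g F(3) by simp
  qed
  ultimately show ?thesis using closed unfolding quandle_def by blast
qed

text \<open>\<open>\<langle>\<zeta>\<^sup>G\<rangle>\<close> is the smallest normal subgroup of \<open>G\<close> containing \<open>\<zeta>\<close>.\<close>

lemma conj_generate_least_normal:
  assumes sub: "subgroup G (BijGroup Q)" and z: "\<zeta> \<in> G"
  shows "generate (perm_group Q G) (perm_conj Q \<zeta> ` G) \<lhd> perm_group Q G"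
    and "\<zeta> \<in> generate (perm_group Q G) (perm_conj Q \<zeta> ` G)"
    and "\<And>N. N \<lhd> perm_group Q G \<Longrightarrow> \<zeta> \<in> N \<Longrightarrow>
      generate (perm_group Q G) (perm_conj Q \<zeta> ` G) \<subseteq> N"
proof -
  interpret B: group "BijGroup Q" by (rule group_BijGroup)
  interpret P: group "perm_group Q G" using B.subgroup_imp_group[OF sub] .
  have conj: "perm_conj Q a g = g \<otimes>\<^bsub>perm_group Q G\<^esub> a \<otimes>\<^bsub>perm_group Q G\<^esub> inv\<^bsub>perm_group Q G\<^esub> g"
    if "g \<in> G" for a g
    using B.m_inv_consistent[OF sub that] by (simp add: perm_conj_def)
  have closed: "perm_conj Q \<zeta> g \<in> G" if "g \<in> G" for g
    using conj[OF that] z that P.m_closed P.inv_closed by simp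
  show "generate (perm_group Q G) (perm_conj Q \<zeta> ` G) \<lhd> perm_group Q G"
  proof (rule P.normal_generateI)
    show "perm_conj Q \<zeta> ` G \<subseteq> carrier (perm_group Q G)" using closed by auto
  next
    fix h g assume "h \<in> perm_conj Q \<zeta> ` G" and g: "g \<in> carrier (perm_group Q G)"
    then obtain k where k: "k \<in> G" "h = perm_conj Q \<zeta> k" by blast
    have gk: "g \<otimes>\<^bsub>perm_group Q G\<^esub> k \<in> G" using P.m_closed[of g k] g k by simp
    have "g \<otimes>\<^bsub>perm_group Q G\<^esub> h \<otimes>\<^bsub>perm_group Q G\<^esub> inv\<^bsub>perm_group Q G\<^esub> g =
        perm_conj Q \<zeta> (g \<otimes>\<^bsub>perm_group Q G\<^esub> k)"
    proof -
      have c: "k \<in> carrier (perm_group Q G)" "\<zeta> \<in> carrier (perm_group Q G)" using k z by auto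
      show ?thesis
        unfolding k(2) conj[OF k(1)] conj[OF gk]
        using c g by (simp only: P.m_assoc P.inv_mult_group P.m_closed P.inv_closed)
    qed
    then show "g \<otimes>\<^bsub>perm_group Q G\<^esub> h \<otimes>\<^bsub>perm_group Q G\<^esub> inv\<^bsub>perm_group Q G\<^esub> g
        \<in> perm_conj Q \<zeta> ` G"
      using gk by (metis imageI)
  qed
  have one: "\<one>\<^bsub>BijGroup Q\<^esub> \<in> G" using sub by (rule subgroup.one_closed)
  have "\<zeta> \<in> carrier (BijGroup Q)" using subgroup.subset[OF sub] z by blast
  then have "perm_conj Q \<zeta> \<one>\<^bsub>BijGroup Q\<^esub> = \<zeta>" by (simp add: perm_conj_def)
  then show "\<zeta> \<in> generate (perm_group Q G) (perm_conj Q \<zeta> ` G)"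
    using one by (metis generate.incl imageI)
  fix N assume N: "N \<lhd> perm_group Q G" and zN: "\<zeta> \<in> N"
  have "perm_conj Q \<zeta> ` G \<subseteq> N"
    using normal.inv_op_closed2[OF N _ zN] conj by auto
  then show "generate (perm_group Q G) (perm_conj Q \<zeta> ` G) \<subseteq> N"
    using P.generate_subgroup_incl N by (simp add: normal_imp_subgroup)
qed

end

theory Submission
  imports Defs
begin

text \<open>
  The right translations of \<open>\<Q>(G, \<zeta>)\<close> are the conjugates of \<open>\<zeta>\<close> under \<open>G\<close>, with \<open>R\<^sub>e = \<zeta>\<close>, and they
  generate \<open>G\<close>. A quandle isomorphism fixing \<open>e\<close> conjugates the translation by \<open>y\<close> to that by the image of \<open>y\<close>, hence
  \<open>\<zeta>\<close> to \<open>\<xi>\<close> and \<open>G\<close> to \<open>K\<close>. A permutation \<open>\<phi>\<close> fixing \<open>e\<close> that conjugates \<open>G\<close> to \<open>K\<close> maps \<open>g e\<close>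
  to \<open>g\<^sup>\<phi> e\<close>, so by transitivity it is determined by conjugation on \<open>G\<close>; conversely, \<open>g e \<mapsto> \<psi>(g) e\<close>
  is a well-defined permutation as soon as \<open>\<psi>\<close> matches the stabilizers of \<open>e\<close>.
\<close>

section \<open>Permutations of \<open>Q\<close> and conjugation\<close>

lemma Bij_eqI:
  assumes "f \<in> Bij Q" "g \<in> Bij Q" "\<And>x. x \<in> Q \<Longrightarrow> f x = g x"
  shows "f = g"
  using assms extensionalityI[of f Q g] by (auto simp: Bij_def)

lemma Bij_image: "f \<in> Bij Q \<Longrightarrow> f ` Q = Q"
  by (simp add: Bij_def bij_betw_def)

lemma Bij_eq_iff: "f \<in> Bij Q \<Longrightarrow> x \<in> Q \<Longrightarrow> y \<in> Q \<Longrightarrow> f x = f y \<longleftrightarrow> x = y"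
  by (auto simp: Bij_def bij_betw_def dest: inj_onD)

text \<open>Every point of \<open>Q\<close> has the form \<open>\<phi> x\<close>, and there the
  conjugate takes the value \<open>\<phi> (a x)\<close>. Identities between conjugates thus reduce
  to pointwise intertwining, with no inverse in sight.\<close>

lemma perm_conj_eqI:
  assumes a: "a \<in> Bij Q" and b: "b \<in> Bij Q" and p: "\<phi> \<in> Bij Q"
    and eq: "\<And>x. x \<in> Q \<Longrightarrow> \<phi> (a x) = b (\<phi> x)"
  shows "perm_conj Q a \<phi> = b"
proof (rule Bij_eqI[OF perm_conj_Bij[OF a p] b])
  fix y assume "y \<in> Q"
  then obtain x where x: "x \<in> Q" "y = \<phi> x" using Bij_image[OF p] by blast
  then show "perm_conj Q a \<phi> y = b y" using perm_conj_apply[OF a p] eq by simp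
qed

lemma BijGroup_mult_Bij:
  assumes "a \<in> Bij Q" "b \<in> Bij Q"
  shows "a \<otimes>\<^bsub>BijGroup Q\<^esub> b \<in> Bij Q"
proof -
  interpret group "BijGroup Q" by (rule group_BijGroup)
  show ?thesis using assms by (simp flip: carrier_BijGroup)
qed

lemma perm_conj_mult:
  assumes a: "a \<in> Bij Q" and b: "b \<in> Bij Q" and p: "\<phi> \<in> Bij Q"
  shows "perm_conj Q (a \<otimes>\<^bsub>BijGroup Q\<^esub> b) \<phi> = perm_conj Q a \<phi> \<otimes>\<^bsub>BijGroup Q\<^esub> perm_conj Q b \<phi>"
  using a b p
  by (intro perm_conj_eqI)
    (simp_all add: BijGroup_mult_Bij perm_conj_Bij BijGroup_mult_apply perm_conj_apply Bij_mem)

text \<open>Taking all of \<open>BijGroup Q\<close> as source and target allows images of generated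
  subgroups to be computed before the image of \<open>G\<close> is known to be
  \<open>K\<close>.\<close>

lemma perm_conj_group_hom:
  assumes "\<phi> \<in> Bij Q"
  shows "group_hom (BijGroup Q) (BijGroup Q) (\<lambda>a. perm_conj Q a \<phi>)"
  using assms
  by (auto simp: group_hom_def group_hom_axioms_def hom_def carrier_BijGroup group_BijGroup perm_conj_Bij perm_conj_mult)

lemma perm_conj_inj_on:
  assumes p: "\<phi> \<in> Bij Q"
  shows "inj_on (\<lambda>a. perm_conj Q a \<phi>) (Bij Q)"
proof (rule inj_onI)
  fix a b assume a: "a \<in> Bij Q" and b: "b \<in> Bij Q" and eq: "perm_conj Q a \<phi> = perm_conj Q b \<phi>"
  show "a = b"
  proof (rule Bij_eqI[OF a b])
    fix x assume x: "x \<in> Q"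
    then have "\<phi> (a x) = \<phi> (b x)" using perm_conj_apply[OF a p x] perm_conj_apply[OF b p x] eq by simp
    then show "a x = b x" using Bij_eq_iff[OF p Bij_mem[OF a x] Bij_mem[OF b x]] by simp
  qed
qed

text \<open>Conjugation by \<open>\<phi>\<close> is an endomorphism, so it respects the conjugation
  of \<open>z\<close> by \<open>g\<close>. Both sides are compared at the points
  \<open>\<phi> (g u)\<close>.\<close>

lemma perm_conj_perm_conj:
  assumes z: "z \<in> Bij Q" and g: "g \<in> Bij Q" and p: "\<phi> \<in> Bij Q"
  shows "perm_conj Q (perm_conj Q z g) \<phi> = perm_conj Q (perm_conj Q z \<phi>) (perm_conj Q g \<phi>)"
proof (rule perm_conj_eqI)
  fix x assume "x \<in> Q"
  then obtain u where u: "u \<in> Q" "x = g u" using Bij_image[OF g] by blast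
  have "perm_conj Q (perm_conj Q z \<phi>) (perm_conj Q g \<phi>) (perm_conj Q g \<phi> (\<phi> u))
      = perm_conj Q g \<phi> (perm_conj Q z \<phi> (\<phi> u))"
    using assms u by (intro perm_conj_apply) (simp_all add: perm_conj_Bij Bij_mem)
  then show "\<phi> (perm_conj Q z g x) = perm_conj Q (perm_conj Q z \<phi>) (perm_conj Q g \<phi>) (\<phi> x)"
    using assms u by (simp add: perm_conj_apply Bij_mem)
qed (use assms in \<open>simp_all add: perm_conj_Bij\<close>)

lemma perm_stab_eq: "perm_stab Q G e = {g \<in> G. g e = e}"
  by (auto simp: stabilizer_def)

section \<open>Right translations of an envelope as generators of its group\<close>

lemma envelope_op_base:
  assumes env: "quandle_envelope Q e G \<zeta>" and e: "e \<in> Q"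
  shows "envelope_op e Q G \<zeta> x e = \<zeta> x"
proof -
  note F = envelope_facts[OF env]
  have zB: "\<zeta> \<in> Bij Q" using F(1,2) by blast
  \<comment> \<open>Since \<open>\<zeta>\<close> lies in \<open>G\<close> and fixes
    \<open>e\<close>, it can itself serve as the representative of \<open>e\<close>.\<close>
  have "envelope_op e Q G \<zeta> x e = perm_conj Q \<zeta> \<zeta> x"
    using envelope_op_eq[OF env e F(2) F(3)] .
  also have "perm_conj Q \<zeta> \<zeta> = \<zeta>" using zB by (intro perm_conj_eqI) auto
  finally show ?thesis .
qed

text \<open>Moves the generation condition from \<open>G\<close> to the ambient group, where
  conjugation by \<open>\<phi>\<close> is a homomorphism.\<close>

lemma envelope_generate:
  assumes env: "quandle_envelope Q e G \<zeta>"
  shows "generate (BijGroup Q) (perm_conj Q \<zeta> ` G) = G"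
proof -
  interpret group "BijGroup Q" by (rule group_BijGroup)
  have sub: "subgroup G (BijGroup Q)"
    and gen: "generate (perm_group Q G) (perm_conj Q \<zeta> ` G) = G"
    using env by (simp_all add: quandle_envelope_def)
  have "perm_conj Q \<zeta> ` G \<subseteq> G"
    using gen generate.incl[of _ "perm_conj Q \<zeta> ` G" "perm_group Q G"] by blast
  then show ?thesis using generate_consistent[OF _ sub] gen by metis
qed

lemma perm_conj_iso:
  assumes G: "subgroup G (BijGroup Q)" and p: "\<phi> \<in> Bij Q" and im: "(\<lambda>\<alpha>. perm_conj Q \<alpha> \<phi>) ` G = K"
  shows "(\<lambda>\<alpha>\<in>G. perm_conj Q \<alpha> \<phi>) \<in> iso (perm_group Q G) (perm_group Q K)"
proof (rule isoI)
  have sub: "G \<subseteq> Bij Q" using subgroup.subset[OF G] by (simp add: carrier_BijGroup)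
  show "bij_betw (\<lambda>\<alpha>\<in>G. perm_conj Q \<alpha> \<phi>) (carrier (perm_group Q G)) (carrier (perm_group Q K))"
    using inj_on_subset[OF perm_conj_inj_on[OF p] sub] im by (auto simp: bij_betw_def inj_on_def)
  show "(\<lambda>\<alpha>\<in>G. perm_conj Q \<alpha> \<phi>) \<in> hom (perm_group Q G) (perm_group Q K)"
    using im sub subgroup.m_closed[OF G] by (auto simp: hom_def perm_conj_mult[OF _ _ p] subset_iff)
qed

section \<open>Quandle isomorphisms fixing \<open>e\<close> as conjugating permutations\<close>

lemma quandle_iso_conj:
  assumes e: "e \<in> Q" and envG: "quandle_envelope Q e G \<zeta>" and envK: "quandle_envelope Q e K \<xi>"
    and iso: "\<phi> \<in> quandle_iso Q (envelope_op e Q G \<zeta>) Q (envelope_op e Q K \<xi>)" and pe: "\<phi> e = e"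
  shows "\<phi> \<in> Bij Q" and "perm_conj Q \<zeta> \<phi> = \<xi>" and "(\<lambda>\<alpha>. perm_conj Q \<alpha> \<phi>) ` G = K"
proof -
  note FG = envelope_facts[OF envG] and FK = envelope_facts[OF envK]
  have zB: "\<zeta> \<in> Bij Q" and xB: "\<xi> \<in> Bij Q" using FG(1,2) FK(1,2) by auto
  show p: "\<phi> \<in> Bij Q" using iso by (simp add: quandle_iso_def binop_iso_def Bij_def)
  have op: "\<phi> (envelope_op e Q G \<zeta> x y) = envelope_op e Q K \<xi> (\<phi> x) (\<phi> y)"
    if "x \<in> Q" "y \<in> Q" for x y
    using iso that by (simp add: quandle_iso_def binop_iso_def)
  \<comment> \<open>This is the homomorphism law with second argument \<open>e\<close>, where the
    translations are \<open>\<zeta>\<close> and \<open>\<xi>\<close>.\<close>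
  show "perm_conj Q \<zeta> \<phi> = \<xi>"
    using op[OF _ e] pe
    by (intro perm_conj_eqI zB xB p) (simp add: envelope_op_base[OF envG e] envelope_op_base[OF envK e])
  \<comment> \<open>The two sides are the conjugated translation by \<open>g e\<close> and the
    translation by its image; any representative \<open>k\<close> of that image will do.\<close>
  have translation: "perm_conj Q (perm_conj Q \<zeta> g) \<phi> = perm_conj Q \<xi> k"
    if g: "g \<in> G" and k: "k \<in> K" and eq: "\<phi> (g e) = k e" for g k
  proof (rule perm_conj_eqI)
    have gB: "g \<in> Bij Q" using g FG(1) by blast
    fix x assume "x \<in> Q"
    then show "\<phi> (perm_conj Q \<zeta> g x) = perm_conj Q \<xi> k (\<phi> x)"
      using op[of x "g e"] envelope_op_eq[OF envG e g refl] envelope_op_eq[OF envK e k eq[symmetric]]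
        Bij_mem[OF gB e] by simp
  qed (use p zB xB g k FG(1) FK(1) in \<open>auto intro!: perm_conj_Bij\<close>)
  \<comment> \<open>The generating sets correspond. Transitivity of \<open>K\<close> supplies a
    representative of \<open>\<phi> (g e)\<close>, and transitivity of \<open>G\<close> one of the
    preimage of \<open>k e\<close>.\<close>
  have "(\<lambda>\<alpha>. perm_conj Q \<alpha> \<phi>) ` perm_conj Q \<zeta> ` G = perm_conj Q \<xi> ` K"
  proof (intro equalityI subsetI)
    fix a assume "a \<in> (\<lambda>\<alpha>. perm_conj Q \<alpha> \<phi>) ` perm_conj Q \<zeta> ` G"
    then obtain g where g: "g \<in> G" "a = perm_conj Q (perm_conj Q \<zeta> g) \<phi>" by blast
    have "\<phi> (g e) \<in> Q" using Bij_mem[OF p Bij_mem[OF subsetD[OF FG(1) g(1)] e]] .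
    then obtain k where "k \<in> K" "k e = \<phi> (g e)" using FK(5)[OF e] by blast
    then show "a \<in> perm_conj Q \<xi> ` K" using translation g by (metis imageI)
  next
    fix a assume "a \<in> perm_conj Q \<xi> ` K"
    then obtain k where k: "k \<in> K" "a = perm_conj Q \<xi> k" by blast
    have "k e \<in> Q" using Bij_mem[OF subsetD[OF FK(1) k(1)] e] .
    then obtain y where y: "y \<in> Q" "\<phi> y = k e" using Bij_image[OF p] by (metis imageE)
    then obtain g where "g \<in> G" "g e = y" using FG(5)[OF e] by blast
    then show "a \<in> (\<lambda>\<alpha>. perm_conj Q \<alpha> \<phi>) ` perm_conj Q \<zeta> ` G"
      using translation k y by (metis imageI)
  qed
  moreover have "perm_conj Q \<zeta> ` G \<subseteq> carrier (BijGroup Q)"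
    using zB FG(1) by (auto simp: carrier_BijGroup intro!: perm_conj_Bij)
  \<comment> \<open>The homomorphic image of a generated subgroup is generated by the image of the
    generators.\<close>
  ultimately show "(\<lambda>\<alpha>. perm_conj Q \<alpha> \<phi>) ` G = K"
    using group_hom.generate_img[OF perm_conj_group_hom[OF p], of "perm_conj Q \<zeta> ` G"]
    by (simp add: envelope_generate[OF envG] envelope_generate[OF envK])
qed

text \<open>If \<open>g\<close> represents \<open>y\<close> in \<open>G\<close>, then its conjugate
  by \<open>\<phi>\<close> lies in \<open>K\<close> and represents \<open>\<phi> y\<close>, because
  \<open>\<phi>\<close> fixes \<open>e\<close>. With this representative the homomorphism law
  becomes compatibility of the two conjugations.\<close>

lemma conj_quandle_iso:
  assumes e: "e \<in> Q" and envG: "quandle_envelope Q e G \<zeta>" and envK: "quandle_envelope Q e K \<xi>"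
    and p: "\<phi> \<in> Bij Q" and pe: "\<phi> e = e" and zx: "perm_conj Q \<zeta> \<phi> = \<xi>"
    and im: "(\<lambda>\<alpha>. perm_conj Q \<alpha> \<phi>) ` G = K"
  shows "\<phi> \<in> quandle_iso Q (envelope_op e Q G \<zeta>) Q (envelope_op e Q K \<xi>)"
proof -
  note FG = envelope_facts[OF envG]
  have zB: "\<zeta> \<in> Bij Q" using FG(1,2) by auto
  have "\<phi> (envelope_op e Q G \<zeta> x y) = envelope_op e Q K \<xi> (\<phi> x) (\<phi> y)"
    if x: "x \<in> Q" and y: "y \<in> Q" for x y
  proof -
    obtain g where g: "g \<in> G" "g e = y" using FG(5)[OF e y] by blast
    have gB: "g \<in> Bij Q" using g FG(1) by blast
    have k: "perm_conj Q g \<phi> \<in> K" using im g by blast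
    have "perm_conj Q g \<phi> e = \<phi> y" using perm_conj_apply[OF gB p e] pe g by simp
    then have "envelope_op e Q K \<xi> (\<phi> x) (\<phi> y) = perm_conj Q \<xi> (perm_conj Q g \<phi>) (\<phi> x)"
      using envelope_op_eq[OF envK e k] by simp
    also have "\<dots> = perm_conj Q (perm_conj Q \<zeta> g) \<phi> (\<phi> x)"
      using perm_conj_perm_conj[OF zB gB p] zx by simp
    also have "\<dots> = \<phi> (perm_conj Q \<zeta> g x)"
      using perm_conj_apply[OF perm_conj_Bij[OF zB gB] p x] .
    finally show ?thesis using envelope_op_eq[OF envG e g] by simp
  qed
  then show ?thesis
    using p envelope_op_quandle[OF envG e] envelope_op_quandle[OF envK e]
    by (simp add: quandle_iso_def binop_iso_def Bij_def)
qed

section \<open>Conjugating permutations and isomorphisms that match the stabilizers\<close>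

lemma perm_conj_stab:
  assumes e: "e \<in> Q" and G: "G \<subseteq> Bij Q" and p: "\<phi> \<in> Bij Q" and pe: "\<phi> e = e"
    and im: "(\<lambda>\<alpha>. perm_conj Q \<alpha> \<phi>) ` G = K"
  shows "(\<lambda>\<alpha>\<in>G. perm_conj Q \<alpha> \<phi>) ` perm_stab Q G e = perm_stab Q K e"
proof -
  have "perm_conj Q g \<phi> e = e \<longleftrightarrow> g e = e" if g: "g \<in> G" for g
  proof -
    have gB: "g \<in> Bij Q" using g G by blast
    have "perm_conj Q g \<phi> e = \<phi> (g e)" using perm_conj_apply[OF gB p e] pe by simp
    then show ?thesis using Bij_eq_iff[OF p Bij_mem[OF gB e] e] pe by simp
  qed
  then show ?thesis unfolding perm_stab_eq using im by auto
qed

text \<open>Since \<open>\<phi>\<close> fixes \<open>e\<close>, it sends \<open>g e\<close> to the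
  value at \<open>e\<close> of the conjugate of \<open>g\<close>, and the points \<open>g e\<close>
  exhaust \<open>Q\<close>. This gives injectivity of the map to \<open>C\<close>.\<close>

lemma perm_conj_determines:
  assumes e: "e \<in> Q" and G: "G \<subseteq> Bij Q" and trans: "\<And>y. y \<in> Q \<Longrightarrow> \<exists>g\<in>G. g e = y"
    and p: "\<phi> \<in> Bij Q" "\<phi> e = e" and q: "\<phi>' \<in> Bij Q" "\<phi>' e = e"
    and eq: "\<And>g. g \<in> G \<Longrightarrow> perm_conj Q g \<phi> = perm_conj Q g \<phi>'"
  shows "\<phi> = \<phi>'"
proof (rule Bij_eqI[OF p(1) q(1)])
  fix y assume "y \<in> Q"
  then obtain g where g: "g \<in> G" "g e = y" using trans by blast
  have gB: "g \<in> Bij Q" using g G by blast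
  show "\<phi> y = \<phi>' y"
    using perm_conj_apply[OF gB p(1) e] perm_conj_apply[OF gB q(1) e] eq[OF g(1)] g(2) p(2) q(2)
    by simp
qed

text \<open>Transitivity identifies \<open>Q\<close> with the cosets of the stabilizer of
  \<open>e\<close> in \<open>G\<close> and likewise in \<open>K\<close>; \<open>\<psi>\<close>
  matches the stabilizers and so carries cosets to cosets. This gives surjectivity onto
  \<open>C\<close>.\<close>

lemma iso_stab_conj:
  assumes e: "e \<in> Q" and G: "subgroup G (BijGroup Q)" and K: "subgroup K (BijGroup Q)"
    and transG: "\<And>y. y \<in> Q \<Longrightarrow> \<exists>g\<in>G. g e = y" and transK: "\<And>y. y \<in> Q \<Longrightarrow> \<exists>k\<in>K. k e = y"
    and iso: "\<psi> \<in> iso (perm_group Q G) (perm_group Q K)"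
    and stab: "\<psi> ` perm_stab Q G e = perm_stab Q K e"
  shows "\<exists>\<phi>\<in>Bij Q. \<phi> e = e \<and> (\<forall>g\<in>G. perm_conj Q g \<phi> = \<psi> g)"
proof -
  interpret B: group "BijGroup Q" by (rule group_BijGroup)
  have GB: "G \<subseteq> Bij Q" and KB: "K \<subseteq> Bij Q"
    using subgroup.subset[OF G] subgroup.subset[OF K] by (simp_all add: carrier_BijGroup)
  have mult: "\<psi> (g \<otimes>\<^bsub>BijGroup Q\<^esub> h) = \<psi> g \<otimes>\<^bsub>BijGroup Q\<^esub> \<psi> h" if "g \<in> G" "h \<in> G" for g h
    using iso that by (simp add: iso_def hom_def)
  have bij: "bij_betw \<psi> G K" using iso by (simp add: iso_def)
  have closed: "\<psi> g \<in> K" if "g \<in> G" for g using bij that by (auto simp: bij_betw_def)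
  have stab_iff: "\<psi> g e = e \<longleftrightarrow> g e = e" if g: "g \<in> G" for g
  proof
    assume "\<psi> g e = e"
    \<comment> \<open>Some element of the stabilizer has the same image as \<open>g\<close>;
      injectivity of \<open>\<psi>\<close> makes it equal to \<open>g\<close>.\<close>
    then have "\<psi> g \<in> \<psi> ` {g \<in> G. g e = e}" using stab closed[OF g] unfolding perm_stab_eq by blast
    then show "g e = e" using bij g by (auto simp: bij_betw_def dest: inj_onD)
  next
    assume "g e = e"
    then show "\<psi> g e = e" using stab g unfolding perm_stab_eq by blast
  qed
  \<comment> \<open>Two elements agree at \<open>e\<close> iff their quotient \<open>k\<close> fixes
    \<open>e\<close>, which \<open>\<psi>\<close> preserves and reflects. From right to left this
    makes \<open>\<phi>\<close> below well defined, from left to right injective.\<close>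
  have coset: "\<psi> g e = \<psi> h e \<longleftrightarrow> g e = h e" if g: "g \<in> G" and h: "h \<in> G" for g h
  proof -
    define k where "k = inv\<^bsub>BijGroup Q\<^esub> h \<otimes>\<^bsub>BijGroup Q\<^esub> g"
    have k: "k \<in> G"
      using G g h unfolding k_def by (simp add: subgroup.m_closed subgroup.m_inv_closed)
    have gk: "g = h \<otimes>\<^bsub>BijGroup Q\<^esub> k"
      using g h GB unfolding k_def carrier_BijGroup[symmetric] by (simp add: subset_iff flip: B.m_assoc)
    have Bs: "h \<in> Bij Q" "k \<in> Bij Q" "\<psi> h \<in> Bij Q" "\<psi> k \<in> Bij Q"
      using h k GB KB closed by auto
    have "g e = h e \<longleftrightarrow> k e = e"
      using Bij_eq_iff[OF Bs(1) Bij_mem[OF Bs(2) e] e] BijGroup_mult_apply[OF Bs(1,2) e] gk by simp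
    moreover have "\<psi> g e = \<psi> h e \<longleftrightarrow> \<psi> k e = e"
      using Bij_eq_iff[OF Bs(3) Bij_mem[OF Bs(4) e] e] BijGroup_mult_apply[OF Bs(3,4) e]
        mult[OF h k] gk by simp
    ultimately show ?thesis using stab_iff[OF k] by simp
  qed
  \<comment> \<open>The choice of \<open>g\<close> is immaterial by \<open>coset\<close>;
    restricting to \<open>Q\<close> gives the extensionality that \<open>Bij Q\<close>
    demands.\<close>
  define \<phi> where "\<phi> = (\<lambda>x\<in>Q. \<psi> (SOME g. g \<in> G \<and> g e = x) e)"
  have orbit: "\<phi> (g e) = \<psi> g e" if g: "g \<in> G" for g
  proof -
    have "\<exists>h. h \<in> G \<and> h e = g e" using g by blast
    from someI_ex[OF this] show ?thesis
      using coset g Bij_mem[OF subsetD[OF GB g] e] by (auto simp: \<phi>_def)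
  qed
  have "\<phi> ` Q = Q"
  proof (intro equalityI subsetI)
    fix y assume "y \<in> \<phi> ` Q"
    then obtain g where "g \<in> G" "y = \<phi> (g e)" using transG by blast
    then show "y \<in> Q" using orbit Bij_mem[OF subsetD[OF KB closed] e] by simp
  next
    fix y assume "y \<in> Q"
    then obtain k where k: "k \<in> K" "k e = y" using transK by blast
    then obtain g where g: "g \<in> G" "\<psi> g = k" using bij by (auto simp: bij_betw_def)
    then have "\<phi> (g e) = y" using orbit k by simp
    then show "y \<in> \<phi> ` Q" using Bij_mem[OF subsetD[OF GB g(1)] e] by blast
  qed
  moreover have "inj_on \<phi> Q"
  proof (rule inj_onI)
    fix x y assume "x \<in> Q" "y \<in> Q" and eq: "\<phi> x = \<phi> y"
    then obtain g h where "g \<in> G" "g e = x" "h \<in> G" "h e = y" using transG by meson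
    then show "x = y" using eq orbit coset by metis
  qed
  ultimately have p: "\<phi> \<in> Bij Q" by (simp add: Bij_def bij_betw_def \<phi>_def)
  have pe: "\<phi> e = e"
  proof -
    obtain g where "g \<in> G" "g e = e" using transG[OF e] by blast
    then show ?thesis using orbit stab_iff by metis
  qed
  show ?thesis
  proof (rule bexI[OF _ p], intro conjI pe ballI, rule perm_conj_eqI[OF _ _ p])
    fix g assume g: "g \<in> G"
    show gB: "g \<in> Bij Q" and pgB: "\<psi> g \<in> Bij Q" using g GB KB closed by auto
    fix x assume "x \<in> Q"
    then obtain h where h: "h \<in> G" "h e = x" using transG by blast
    have hB: "h \<in> Bij Q" "\<psi> h \<in> Bij Q" using h GB KB closed by auto
    \<comment> \<open>If \<open>h\<close> represents \<open>x\<close>, then the product of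
      \<open>g\<close> and \<open>h\<close> represents \<open>g x\<close>, so \<open>orbit\<close>
      applies to it.\<close>
    have "\<phi> (g x) = \<phi> ((g \<otimes>\<^bsub>BijGroup Q\<^esub> h) e)" using BijGroup_mult_apply[OF gB hB(1) e] h by simp
    also have "\<dots> = \<psi> (g \<otimes>\<^bsub>BijGroup Q\<^esub> h) e" using orbit subgroup.m_closed[OF G g h(1)] by simp
    also have "\<dots> = \<psi> g (\<psi> h e)" using mult[OF g h(1)] BijGroup_mult_apply[OF pgB hB(2) e] by simp
    also have "\<psi> h e = \<phi> x" using orbit h by metis
    finally show "\<phi> (g x) = \<psi> g (\<phi> x)" .
  qed
qed

theorem lemma5p5:
  fixes Q :: "'a set" and e :: 'a and G K :: "('a \<Rightarrow> 'a) set" and \<zeta> \<xi> :: "'a \<Rightarrow> 'a"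
  assumes "e \<in> Q"
    and "quandle_envelope Q e G \<zeta>"
    and "quandle_envelope Q e K \<xi>"
  shows
    "let A = {\<phi> \<in> quandle_iso Q (envelope_op e Q G \<zeta>) Q (envelope_op e Q K \<xi>). \<phi> e = e};
         B = {\<phi> \<in> Bij Q. \<phi> e = e \<and> perm_conj Q \<zeta> \<phi> = \<xi> \<and> (\<lambda>\<alpha>. perm_conj Q \<alpha> \<phi>) ` G = K};
         C = {\<psi> \<in> extensional G. \<psi> \<in> iso (perm_group Q G) (perm_group Q K) \<and>
                \<psi> \<zeta> = \<xi> \<and> \<psi> ` perm_stab Q G e = perm_stab Q K e}
     in A = B \<and> bij_betw (\<lambda>\<phi>. \<lambda>\<alpha>\<in>G. perm_conj Q \<alpha> \<phi>) A C"
proof -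
  note e = assms(1) and envG = assms(2) and envK = assms(3)
  note FG = envelope_facts[OF envG] and FK = envelope_facts[OF envK]
  have subG: "subgroup G (BijGroup Q)" and subK: "subgroup K (BijGroup Q)"
    using envG envK by (simp_all add: quandle_envelope_def)
  define A where "A = {\<phi> \<in> quandle_iso Q (envelope_op e Q G \<zeta>) Q (envelope_op e Q K \<xi>). \<phi> e = e}"
  define B where
    "B = {\<phi> \<in> Bij Q. \<phi> e = e \<and> perm_conj Q \<zeta> \<phi> = \<xi> \<and> (\<lambda>\<alpha>. perm_conj Q \<alpha> \<phi>) ` G = K}"
  define C where
    "C = {\<psi> \<in> extensional G. \<psi> \<in> iso (perm_group Q G) (perm_group Q K) \<and>
            \<psi> \<zeta> = \<xi> \<and> \<psi> ` perm_stab Q G e = perm_stab Q K e}"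
  have AB: "A = B"
  proof (intro equalityI subsetI)
    fix \<phi> assume "\<phi> \<in> A"
    then show "\<phi> \<in> B" using quandle_iso_conj[OF e envG envK] by (simp add: A_def B_def)
  next
    fix \<phi> assume "\<phi> \<in> B"
    then show "\<phi> \<in> A" using conj_quandle_iso[OF e envG envK] by (simp add: A_def B_def)
  qed
  have "inj_on (\<lambda>\<phi>. \<lambda>\<alpha>\<in>G. perm_conj Q \<alpha> \<phi>) B"
  proof (rule inj_onI)
    fix \<phi> \<phi>' assume mem: "\<phi> \<in> B" "\<phi>' \<in> B"
      and eq: "(\<lambda>\<alpha>\<in>G. perm_conj Q \<alpha> \<phi>) = (\<lambda>\<alpha>\<in>G. perm_conj Q \<alpha> \<phi>')"
    show "\<phi> = \<phi>'"
    proof (rule perm_conj_determines[OF e FG(1) FG(5)[OF e]])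
      fix g assume "g \<in> G"
      then show "perm_conj Q g \<phi> = perm_conj Q g \<phi>'" using fun_cong[OF eq, of g] by simp
    qed (use mem in \<open>simp_all add: B_def\<close>)
  qed
  moreover have "(\<lambda>\<alpha>\<in>G. perm_conj Q \<alpha> \<phi>) \<in> C" if "\<phi> \<in> B" for \<phi>
    using that perm_conj_iso[OF subG] perm_conj_stab[OF e FG(1)] FG(2) by (simp add: B_def C_def)
  moreover have "\<exists>\<phi>\<in>B. \<psi> = (\<lambda>\<alpha>\<in>G. perm_conj Q \<alpha> \<phi>)" if "\<psi> \<in> C" for \<psi>
  proof -
    have \<psi>: "\<psi> \<in> extensional G" "\<psi> \<in> iso (perm_group Q G) (perm_group Q K)" "\<psi> \<zeta> = \<xi>"
      "\<psi> ` perm_stab Q G e = perm_stab Q K e"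
      using that by (simp_all add: C_def)
    obtain \<phi> where \<phi>: "\<phi> \<in> Bij Q" "\<phi> e = e" "\<forall>g\<in>G. perm_conj Q g \<phi> = \<psi> g"
      using iso_stab_conj[OF e subG subK FG(5)[OF e] FK(5)[OF e] \<psi>(2,4)] by blast
    \<comment> \<open>Conjugation by \<open>\<phi>\<close> agrees with \<open>\<psi>\<close> on
      \<open>G\<close>, which contains \<open>\<zeta>\<close>, so the conditions defining
      \<open>B\<close> are read off from the image of \<open>\<psi>\<close> and its value at
      \<open>\<zeta>\<close>.\<close>
    have "\<psi> ` G = K" using \<psi>(2) by (simp add: iso_def bij_betw_def)
    then have "\<phi> \<in> B" using \<phi> \<psi>(3) FG(2) by (simp add: B_def)
    moreover have "\<psi> = (\<lambda>\<alpha>\<in>G. perm_conj Q \<alpha> \<phi>)"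
      using \<psi>(1) \<phi>(3) by (intro extensionalityI[of _ G]) simp_all
    ultimately show ?thesis by blast
  qed
  ultimately have "bij_betw (\<lambda>\<phi>. \<lambda>\<alpha>\<in>G. perm_conj Q \<alpha> \<phi>) A C"
    unfolding AB bij_betw_def by blast
  with AB show ?thesis unfolding A_def B_def C_def Let_def by (rule conjI)
qed

end
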